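(* Let $p=p_n$ with $p/n^2\to\infty$ as $n\to\infty$, and let $\mu_n$ be the mixture of spherical-cap distributions on $\mathbb{S}^{p-1}$ defined in the context with cap width $\varepsilon_p=1/(4p)$. Let $X_1,\dots,X_n$ be i.i.d. from $\mu_n$. Then the following hold: (i) $\liminf_{n\to\infty}d(\mu_n,\mu_0)\ge 1/10$; (ii) $R_n=\frac{\sqrt{2p}}{n}\sum_{1\le i<j\le n}X_i^\top X_j$ converges to $0$ in probability; (iii) $B_n=\frac pn\sum_{1\le i<j\le n}\big[(X_i^\top X_j)^2-\frac1p\big]$ diverges to $-\infty$ in probability; (iv) $P_n=p\cdot\max_{1\le i<j\le n}(X_i^\top X_j)^2-4\log n+\log\log n$ diverges to $-\infty$ in probability.
   Context: $\mathbb{S}^{p-1}=\{x\in\mathbb{R}^p:\|x\|_2=1\}$ and $\mu_0$ is the uniform distribution on it. For $p\ge3$, let $v_1,\dots,v_{p+1}\in\mathbb{S}^{p-1}$ be points with $v_r^\top v_s=-1/p$ for all $r\ne s$ (vertices of a regular simplex; such points exist). With $\varepsilon_p=1/(4p)$ define the spherical caps $$C_{r,p}=\{x\in\mathbb{S}^{p-1}:\arccos(x^\top v_r)\le\varepsilon_p\},\qquad r=1,\dots,p+1,$$ let $\nu_{r,p}$ be the uniform distribution on $C_{r,p}$, and set $\mu_n=\frac1{p+1}\sum_{r=1}^{p+1}\nu_{r,p}$. For probability measures $\mu,\nu$ on $\mathbb{S}^{p-1}$, $$d(\mu,\nu)=\sup_{t\in[-1,1]}\big|\mathbb{P}_\mu(X_1^\top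 Y_1\le t)-\mathbb{P}_\nu(X^\top Y\le t)\big|,$$ where $X_1,Y_1$ are drawn independently from $\mu$ and $X,Y$ independently from $\nu$. "Diverges to $-\infty$ in probability" means that for every $M>0$ the probability of being below $-M$ tends to $1$. *)

theory Defs
  imports "HOL-Probability.Probability"
begin

text \<open>
  The dimension varies with the sample size, so vectors of \<open>\<real>\<^sup>p\<close> are extensional functions on
  \<open>{..<p}\<close>, i.e. the points of the product space over that index set. Probability measures on
  the unit sphere are taken as measures on the Borel space of \<open>\<real>\<^sup>p\<close> that are concentrated
  on the sphere.
\<close>

abbreviation borel_vec :: "nat \<Rightarrow> (nat \<Rightarrow> real) measure" where
  "borel_vec p \<equiv> Pi\<^sub>M {..<p} (\<lambda>_. borel)"

abbreviation lebesgue_vec :: "nat \<Rightarrow> (nat \<Rightarrow> real) measure" where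
  "lebesgue_vec p \<equiv> Pi\<^sub>M {..<p} (\<lambda>_. lborel)"

definition dot :: "nat \<Rightarrow> (nat \<Rightarrow> real) \<Rightarrow> (nat \<Rightarrow> real) \<Rightarrow> real" where
  "dot p x y = (\<Sum>i<p. x i * y i)"

definition unit_sphere :: "nat \<Rightarrow> (nat \<Rightarrow> real) set" where
  "unit_sphere p = {x \<in> space (borel_vec p). L2_set x {..<p} = 1}"

definition unit_ball :: "nat \<Rightarrow> (nat \<Rightarrow> real) set" where
  "unit_ball p = {x \<in> space (borel_vec p). L2_set x {..<p} \<le> 1}"

definition normalize_vec :: "nat \<Rightarrow> (nat \<Rightarrow> real) \<Rightarrow> (nat \<Rightarrow> real)" where
  "normalize_vec p x = (\<lambda>i\<in>{..<p}. x i / L2_set x {..<p})"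

text \<open>
  Normalized surface measure as cone measure: a Borel subset \<open>A\<close> of the sphere receives the
  Lebesgue volume of \<open>{r x | 0 < r \<le> 1, x \<in> A}\<close> divided by the volume of the ball. The
  origin, which normalization leaves off the sphere, is a null set (for \<open>p \<ge> 1\<close>).
\<close>

definition uniform_sphere :: "nat \<Rightarrow> (nat \<Rightarrow> real) measure" where
  "uniform_sphere p =
     distr (uniform_measure (lebesgue_vec p) (unit_ball p)) (borel_vec p) (normalize_vec p)"

definition regular_simplex :: "nat \<Rightarrow> (nat \<Rightarrow> nat \<Rightarrow> real) \<Rightarrow> bool" where
  "regular_simplex p v \<longleftrightarrow>
     (\<forall>r\<in>{1..p + 1}. v r \<in> unit_sphere p) \<and>
     (\<forall>r\<in>{1..p + 1}. \<forall>s\<in>{1..p + 1}. r \<noteq> s \<longrightarrow> dot p (v r) (v s) = - 1 / real p)"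

definition cap_width :: "nat \<Rightarrow> real" where
  "cap_width p = 1 / (4 * real p)"

definition cap :: "nat \<Rightarrow> (nat \<Rightarrow> real) \<Rightarrow> (nat \<Rightarrow> real) set" where
  "cap p w = {x \<in> unit_sphere p. arccos (dot p x w) \<le> cap_width p}"

definition uniform_cap :: "nat \<Rightarrow> (nat \<Rightarrow> real) \<Rightarrow> (nat \<Rightarrow> real) measure" where
  "uniform_cap p w = uniform_measure (uniform_sphere p) (cap p w)"

definition cap_mixture :: "nat \<Rightarrow> (nat \<Rightarrow> nat \<Rightarrow> real) \<Rightarrow> (nat \<Rightarrow> real) measure" where
  "cap_mixture p v = measure_of (space (borel_vec p)) (sets (borel_vec p))
     (\<lambda>A. (\<Sum>r = 1..p + 1. emeasure (uniform_cap p (v r)) A) / of_nat (p + 1))"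

definition dot_dist :: "nat \<Rightarrow> (nat \<Rightarrow> real) measure \<Rightarrow> (nat \<Rightarrow> real) measure \<Rightarrow> real" where
  "dot_dist p \<mu> \<nu> = (SUP t\<in>{-1..1}.
     \<bar>\<P>(z in \<mu> \<Otimes>\<^sub>M \<mu>. dot p (fst z) (snd z) \<le> t) - \<P>(z in \<nu> \<Otimes>\<^sub>M \<nu>. dot p (fst z) (snd z) \<le> t)\<bar>)"

definition iid_sample ::
  "'w measure \<Rightarrow> (nat \<Rightarrow> 'w \<Rightarrow> 'b) \<Rightarrow> nat \<Rightarrow> 'b measure \<Rightarrow> bool" where
  "iid_sample M X n \<mu> \<longleftrightarrow>
     prob_space.indep_vars M (\<lambda>_. \<mu>) X {1..n} \<and> (\<forall>i\<in>{1..n}. distr M \<mu> (X i) = \<mu>)"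

definition pairs :: "nat \<Rightarrow> (nat \<times> nat) set" where
  "pairs n = {(i, j). 1 \<le> i \<and> i < j \<and> j \<le> n}"

text \<open>The three statistics as functions of the data \<open>x 1, \<dots>, x n\<close>.\<close>

definition R_stat :: "nat \<Rightarrow> nat \<Rightarrow> (nat \<Rightarrow> nat \<Rightarrow> real) \<Rightarrow> real" where
  "R_stat p n x = sqrt (2 * real p) / real n * (\<Sum>(i, j)\<in>pairs n. dot p (x i) (x j))"

definition B_stat :: "nat \<Rightarrow> nat \<Rightarrow> (nat \<Rightarrow> nat \<Rightarrow> real) \<Rightarrow> real" where
  "B_stat p n x =
     real p / real n * (\<Sum>(i, j)\<in>pairs n. (dot p (x i) (x j))\<^sup>2 - 1 / real p)"

text \<open>Only meaningful for \<open>n \<ge> 2\<close>, where the set of pairs is nonempty.\<close>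

definition P_stat :: "nat \<Rightarrow> nat \<Rightarrow> (nat \<Rightarrow> nat \<Rightarrow> real) \<Rightarrow> real" where
  "P_stat p n x =
     real p * (MAX (i, j)\<in>pairs n. (dot p (x i) (x j))\<^sup>2) - 4 * ln (real n) + ln (ln (real n))"

text \<open>The underlying probability space may change with \<open>n\<close>.\<close>

definition converges_in_prob ::
  "(nat \<Rightarrow> 'w measure) \<Rightarrow> (nat \<Rightarrow> 'w \<Rightarrow> real) \<Rightarrow> real \<Rightarrow> bool" where
  "converges_in_prob M Z c \<longleftrightarrow>
     (\<forall>e>0. (\<lambda>n. \<P>(w in M n. \<bar>Z n w - c\<bar> > e)) \<longlonglongrightarrow> 0)"

definition diverges_to_minus_infinity_in_prob ::
  "(nat \<Rightarrow> 'w measure) \<Rightarrow> (nat \<Rightarrow> 'w \<Rightarrow> real) \<Rightarrow> bool" where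
  "diverges_to_minus_infinity_in_prob M Z \<longleftrightarrow>
     (\<forall>K>0. (\<lambda>n. \<P>(w in M n. Z n w < - K)) \<longlonglongrightarrow> 1)"

end

theory Submission
  imports Defs "HOL-Real_Asymp.Real_Asymp"
begin

text \<open>
  The cap width is so small that points of different caps have inner product between
  \<open>-3/(2p)\<close> and \<open>-1/(2p)\<close>, while two independent draws fall into the same cap with probability
  at most \<open>1/(p+1)\<close>. By a union bound, all \<open>n\<close> sample points lie in different caps with probability at
  least \<open>1 - n\<^sup>2/p\<close>, and on that event the three statistics are controlled deterministically. For the
  distance take \<open>t = -1/(2p)\<close>: the mixture puts mass at least \<open>1 - 1/(p+1)\<close> on inner products
  below \<open>t\<close>, the uniform distribution at most \<open>1/2\<close> by central symmetry.

  That caps have positive measure is never needed: if a cap were null, its \<open>uniform_cap\<close>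
  would be the zero measure (\<open>0 / 0 = 0\<close> for \<open>ennreal\<close>), all bounds from above would survive, and
  the mixture has total mass 1 because it is the law of \<open>X 1\<close>.
\<close>

section \<open>Inner products of points in small caps\<close>

lemma abs_dot_le_L2_set: "\<bar>dot p x y\<bar> \<le> L2_set x {..<p} * L2_set y {..<p}"
proof -
  have "\<bar>dot p x y\<bar> \<le> (\<Sum>i<p. \<bar>x i\<bar> * \<bar>y i\<bar>)"
    unfolding dot_def by (rule order_trans[OF sum_abs]) (simp add: abs_mult)
  then show ?thesis
    using L2_set_mult_ineq[of x y "{..<p}"] by linarith
qed

lemma L2_set_diff_squared:
  "(L2_set (\<lambda>i. x i - w i) {..<p})\<^sup>2
     = (L2_set x {..<p})\<^sup>2 + (L2_set w {..<p})\<^sup>2 - 2 * dot p x w"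
proof -
  have sq: "(L2_set z {..<p})\<^sup>2 = (\<Sum>i<p. (z i)\<^sup>2)" for z :: "nat \<Rightarrow> real"
    by (simp add: L2_set_def sum_nonneg)
  show ?thesis
    unfolding sq by (simp add: dot_def power2_diff sum.distrib sum_subtractf sum_distrib_left mult.assoc)
qed

lemma one_minus_cos_le: "1 - cos t \<le> t\<^sup>2 / 2" for t :: real
proof -
  have "cos t = 1 - 2 * (sin (t / 2))\<^sup>2"
    using cos_double_sin[of "t / 2"] by simp
  moreover have "(sin (t / 2))\<^sup>2 \<le> (t / 2)\<^sup>2"
    using abs_sin_x_le_abs_x[of "t / 2"] by (rule iffD1[OF abs_le_square_iff])
  ultimately show ?thesis by (simp add: power2_eq_square)
qed

text \<open>The case \<open>p = 0\<close> rests on the convention \<open>1 / 0 = 0\<close>. The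
  upper bound keeps the width below \<open>pi\<close>, in the range where \<open>arccos\<close>
  inverts \<open>cos\<close>.\<close>

lemma cap_width_bounds: "0 \<le> cap_width p" "cap_width p \<le> 1"
  by (cases "p = 0"; simp add: cap_width_def field_simps)+

text \<open>Since \<open>arccos\<close> is decreasing on \<open>[-1, 1]\<close>, where
  Cauchy-Schwarz places the inner product, a cap is the part of the sphere in a half-space. This
  form serves both the measurability of caps and the distance estimate.\<close>

lemma cap_eq_dot_ge:
  assumes w: "w \<in> unit_sphere p"
  shows "cap p w = {x \<in> unit_sphere p. cos (cap_width p) \<le> dot p x w}"
proof -
  have "arccos (dot p x w) \<le> cap_width p \<longleftrightarrow> cos (cap_width p) \<le> dot p x w"
    if x: "x \<in> unit_sphere p" for x
  proof -
    have "\<bar>dot p x w\<bar> \<le> 1"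
      using abs_dot_le_L2_set[of p x w] x w by (simp add: unit_sphere_def)
    then show ?thesis
      using arccos_le_mono[of "dot p x w" "cos (cap_width p)"] arccos_cos[of "cap_width p"]
        cap_width_bounds[of p] pi_gt3 by simp
  qed
  then show ?thesis unfolding cap_def by blast
qed

text \<open>The chord is no longer than the arc: the squared distance is
  \<open>2 - 2 * dot p x w\<close>, at most \<open>2 * (1 - cos (cap_width p))\<close>, and the
  quadratic bound on \<open>1 - cos\<close> finishes.\<close>

lemma dist_cap_centre:
  assumes "w \<in> unit_sphere p" "x \<in> cap p w"
  shows "L2_set (\<lambda>i. x i - w i) {..<p} \<le> cap_width p"
proof (rule power2_le_imp_le)
  have "L2_set x {..<p} = 1" "L2_set w {..<p} = 1" "cos (cap_width p) \<le> dot p x w"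
    using assms by (auto simp: cap_eq_dot_ge unit_sphere_def)
  then show "(L2_set (\<lambda>i. x i - w i) {..<p})\<^sup>2 \<le> (cap_width p)\<^sup>2"
    unfolding L2_set_diff_squared using one_minus_cos_le[of "cap_width p"] by simp
qed (rule cap_width_bounds)

text \<open>Move one argument at a time, from \<open>x\<close> to \<open>a\<close> and then from
  \<open>y\<close> to \<open>b\<close>. Cauchy-Schwarz against a unit vector makes each move cost at
  most one cap width.\<close>

lemma dot_caps:
  assumes "a \<in> unit_sphere p" "b \<in> unit_sphere p" "x \<in> cap p a" "y \<in> cap p b"
  shows "\<bar>dot p x y - dot p a b\<bar> \<le> 2 * cap_width p"
proof -
  have n: "L2_set a {..<p} = 1" "L2_set y {..<p} = 1"
    using assms by (auto simp: unit_sphere_def cap_def)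
  have "dot p x y - dot p a b = dot p (\<lambda>i. x i - a i) y + dot p a (\<lambda>i. y i - b i)"
    by (simp add: dot_def sum_subtractf algebra_simps)
  also have "\<bar>\<dots>\<bar> \<le> \<bar>dot p (\<lambda>i. x i - a i) y\<bar> + \<bar>dot p a (\<lambda>i. y i - b i)\<bar>"
    by (rule abs_triangle_ineq)
  also have "\<dots> \<le> cap_width p + cap_width p"
    using abs_dot_le_L2_set[of p "\<lambda>i. x i - a i" y] abs_dot_le_L2_set[of p a "\<lambda>i. y i - b i"]
      dist_cap_centre[of a p x] dist_cap_centre[of b p y] assms n
    by (intro add_mono) auto
  finally show ?thesis by simp
qed

text \<open>The interval has centre \<open>- 1 / p\<close>, the inner product of two simplex
  vertices, and radius \<open>1 / (2 * p)\<close>, which is twice the cap width.\<close>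

definition near_obtuse :: "nat \<Rightarrow> (nat \<Rightarrow> real) \<Rightarrow> (nat \<Rightarrow> real) \<Rightarrow> bool" where
  "near_obtuse p x y \<longleftrightarrow> - 3 / (2 * real p) \<le> dot p x y \<and> dot p x y \<le> - 1 / (2 * real p)"

lemma near_obtuse_distinct_caps:
  assumes "regular_simplex p v" "r \<in> {1..p + 1}" "s \<in> {1..p + 1}" "r \<noteq> s"
    and "x \<in> cap p (v r)" "y \<in> cap p (v s)"
  shows "near_obtuse p x y"
proof -
  have "\<bar>dot p x y - dot p (v r) (v s)\<bar> \<le> 2 * cap_width p"
    using assms by (intro dot_caps) (auto simp: regular_simplex_def)
  moreover have "dot p (v r) (v s) = - 1 / real p"
    using assms unfolding regular_simplex_def by blast
  \<comment> \<open>With every bound written as a multiple of the single atom \<open>1 / p\<close>,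
    what remains is linear arithmetic.\<close>
  moreover define q where "q = 1 / real p"
  moreover have "2 * cap_width p = q / 2" "- 1 / real p = - q"
    and eq: "- 3 / (2 * real p) = - 3 / 2 * q" "- 1 / (2 * real p) = - q / 2"
    by (simp_all add: cap_width_def q_def)
  ultimately have "\<bar>dot p x y + q\<bar> \<le> q / 2" by simp
  then show ?thesis
    unfolding near_obtuse_def eq by linarith
qed

lemma near_obtuse_bounds:
  assumes "near_obtuse p x y"
  shows "\<bar>dot p x y\<bar> \<le> 3 / (2 * real p)" and "(dot p x y)\<^sup>2 \<le> 9 / (4 * (real p)\<^sup>2)"
proof -
  show *: "\<bar>dot p x y\<bar> \<le> 3 / (2 * real p)"
  proof -
    have "0 \<le> 1 / real p" by simp
    moreover have "- 3 / (2 * real p) = - 3 / 2 * (1 / real p)" "3 / (2 * real p) = 3 / 2 * (1 / real p)"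
     "- 1 / (2 * real p) = - 1 / 2 * (1 / real p)" by simp_all
    ultimately show ?thesis
      using assms unfolding near_obtuse_def by linarith
  qed
  have "(dot p x y)\<^sup>2 \<le> (3 / (2 * real p))\<^sup>2"
    using power_mono[OF *, of 2] by simp
  then show "(dot p x y)\<^sup>2 \<le> 9 / (4 * (real p)\<^sup>2)"
    by (simp add: power_divide power_mult_distrib)
qed

section \<open>The cap mixture\<close>

lemma measurable_dot [measurable]:
  assumes [measurable]: "f \<in> M \<rightarrow>\<^sub>M borel_vec p" "g \<in> M \<rightarrow>\<^sub>M borel_vec p"
  shows "(\<lambda>w. dot p (f w) (g w)) \<in> borel_measurable M"
  unfolding dot_def
  by (intro borel_measurable_sum borel_measurable_times
      measurable_compose[OF assms(1) measurable_component_singleton]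
      measurable_compose[OF assms(2) measurable_component_singleton]) auto

lemma measurable_L2_set [measurable]:
  "(\<lambda>x. L2_set x {..<p}) \<in> borel_measurable (borel_vec p)"
  unfolding L2_set_def by measurable

lemma measurable_near_obtuse [measurable]:
  assumes [measurable]: "f \<in> M \<rightarrow>\<^sub>M borel_vec p" "g \<in> M \<rightarrow>\<^sub>M borel_vec p"
  shows "Measurable.pred M (\<lambda>w. near_obtuse p (f w) (g w))"
  unfolding near_obtuse_def by measurable

lemma sets_unit_sphere [measurable]: "unit_sphere p \<in> sets (borel_vec p)"
  unfolding unit_sphere_def by measurable

lemma sets_unit_ball: "unit_ball p \<in> sets (borel_vec p)"
  unfolding unit_ball_def by measurable

lemma unit_sphere_subset_space: "unit_sphere p \<subseteq> space (borel_vec p)"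
  by (auto simp: unit_sphere_def)

lemma sets_cap [measurable]:
  assumes w: "w \<in> unit_sphere p"
  shows "cap p w \<in> sets (borel_vec p)"
proof -
  have [measurable]: "w \<in> space (borel_vec p)" using w unit_sphere_subset_space by blast
  have "cap p w = unit_sphere p \<inter> {x \<in> space (borel_vec p). cos (cap_width p) \<le> dot p x w}"
    using unit_sphere_subset_space by (auto simp: cap_eq_dot_ge[OF w])
  also have "\<dots> \<in> sets (borel_vec p)" by measurable
  finally show ?thesis .
qed

lemma sets_lebesgue_vec: "sets (lebesgue_vec p) = sets (borel_vec p)"
  by (intro sets_PiM_cong) auto

lemma sets_uniform_sphere [simp, measurable_cong]: "sets (uniform_sphere p) = sets (borel_vec p)"
  by (simp add: uniform_sphere_def)

lemma sets_uniform_cap [simp, measurable_cong]: "sets (uniform_cap p w) = sets (borel_vec p)"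
  by (simp add: uniform_cap_def)

lemma sets_cap_mixture [simp, measurable_cong]: "sets (cap_mixture p v) = sets (borel_vec p)"
  by (simp add: cap_mixture_def sets.sigma_sets_eq sets.space_closed)

lemma space_cap_mixture [simp]: "space (cap_mixture p v) = space (borel_vec p)"
  by (rule sets_eq_imp_space_eq) simp

text \<open>A measure built by \<open>measure_of\<close> takes the prescribed values only if these
  are countably additive. They are, because finite sums and division by a constant commute with
  series in \<open>ennreal\<close>.\<close>

lemma emeasure_cap_mixture:
  assumes "A \<in> sets (borel_vec p)"
  shows "emeasure (cap_mixture p v) A
    = (\<Sum>r = 1..p + 1. emeasure (uniform_cap p (v r)) A) / of_nat (p + 1)"
proof (rule emeasure_measure_of[OF cap_mixture_def])
  show "countably_additive (sets (cap_mixture p v))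
     (\<lambda>A. (\<Sum>r = 1..p + 1. emeasure (uniform_cap p (v r)) A) / of_nat (p + 1))"
  proof (rule countably_additiveI)
    fix A :: "nat \<Rightarrow> (nat \<Rightarrow> real) set"
    assume "range A \<subseteq> sets (cap_mixture p v)" "disjoint_family A"
    then have "(\<Sum>i. emeasure (uniform_cap p (v r)) (A i)) = emeasure (uniform_cap p (v r)) (\<Union>i. A i)"
      for r by (intro suminf_emeasure) auto
    then show "(\<Sum>i. (\<Sum>r = 1..p + 1. emeasure (uniform_cap p (v r)) (A i)) / of_nat (p + 1))
      = (\<Sum>r = 1..p + 1. emeasure (uniform_cap p (v r)) (\<Union>i. A i)) / of_nat (p + 1)"
      by (simp add: suminf_sum[OF summableI] del: sum.cl_ivl_Suc)
  qed
qed (use assms in \<open>auto simp: positive_def sets.space_closed dest: sets.sets_into_space\<close>)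

text \<open>The quotient is 1 for \<open>0 < a < top\<close> and 0 at both extremes. Hence
  \<open>uniform_measure\<close> has mass at most 1 even when the conditioning set is null or of
  infinite measure.\<close>

lemma ennreal_divide_self_le_1: "a / a \<le> (1 :: ennreal)"
  by (cases "a = 0"; cases "a = top") (auto simp: less_top)

lemma emeasure_uniform_measure_le_1:
  assumes "A \<in> sets M"
  shows "emeasure (uniform_measure M A) B \<le> 1"
proof (cases "B \<in> sets M")
  case True
  then have "emeasure (uniform_measure M A) B = emeasure M (A \<inter> B) / emeasure M A"
    using assms by simp
  also have "\<dots> \<le> emeasure M A / emeasure M A"
    using assms by (intro divide_right_mono_ennreal emeasure_mono) auto
  finally show ?thesis using ennreal_divide_self_le_1 order_trans by blast
qed (simp add: emeasure_notin_sets)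

lemma emeasure_uniform_cap_disjoint:
  assumes "w \<in> unit_sphere p" "B \<in> sets (borel_vec p)" "cap p w \<inter> B = {}"
  shows "emeasure (uniform_cap p w) B = 0"
  using assms sets_cap[OF assms(1)] by (simp add: uniform_cap_def)

text \<open>Every cap other than the one containing \<open>x\<close> misses the exceptional set, so
  only the component of index \<open>r\<close>, of weight \<open>1 / (p + 1)\<close>, can charge
  it.\<close>

lemma cap_mixture_not_near_obtuse:
  assumes v: "regular_simplex p v" and r: "r \<in> {1..p + 1}" and x: "x \<in> cap p (v r)"
  shows "emeasure (cap_mixture p v) {y \<in> space (borel_vec p). \<not> near_obtuse p x y} \<le> 1 / of_nat (p + 1)"
    (is "emeasure _ ?B \<le> _")
proof -
  have vS: "v s \<in> unit_sphere p" if "s \<in> {1..p + 1}" for s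
    using v that by (auto simp: regular_simplex_def)
  have [measurable]: "x \<in> space (borel_vec p)"
    using x unit_sphere_subset_space by (auto simp: cap_def)
  have B[measurable]: "?B \<in> sets (borel_vec p)" by measurable
  have "emeasure (cap_mixture p v) ?B = (\<Sum>s = 1..p + 1. emeasure (uniform_cap p (v s)) ?B) / of_nat (p + 1)"
    by (rule emeasure_cap_mixture) fact
  also have "(\<Sum>s = 1..p + 1. emeasure (uniform_cap p (v s)) ?B)
      = (\<Sum>s = 1..p + 1. if s = r then emeasure (uniform_cap p (v r)) ?B else 0)"
    using near_obtuse_distinct_caps[OF v r _ _ x] vS B
    by (intro sum.cong refl) (auto intro!: emeasure_uniform_cap_disjoint)
  also have "\<dots> = emeasure (uniform_cap p (v r)) ?B"
    using r by (simp del: sum.cl_ivl_Suc)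
  also have "\<dots> \<le> 1"
    unfolding uniform_cap_def using sets_cap[OF vS[OF r]]
    by (intro emeasure_uniform_measure_le_1) simp
  finally show ?thesis by (simp add: divide_right_mono_ennreal)
qed

text \<open>Each component vanishes off its own cap. This supplies the index \<open>r\<close> of the
  cap containing the first point when pairs are integrated.\<close>

lemma AE_cap_mixture:
  assumes v: "regular_simplex p v"
  shows "AE x in cap_mixture p v. \<exists>r\<in>{1..p + 1}. x \<in> cap p (v r)"
proof -
  have vS: "v s \<in> unit_sphere p" if "s \<in> {1..p + 1}" for s
    using v that by (auto simp: regular_simplex_def)
  let ?N = "space (borel_vec p) - (\<Union>r\<in>{1..p + 1}. cap p (v r))"
  have N: "?N \<in> sets (borel_vec p)"
    using vS sets_cap by (intro sets.Diff sets.finite_UN) auto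
  have "emeasure (cap_mixture p v) ?N = (\<Sum>s = 1..p + 1. emeasure (uniform_cap p (v s)) ?N) / of_nat (p + 1)"
    by (rule emeasure_cap_mixture) fact
  also have "(\<Sum>s = 1..p + 1. emeasure (uniform_cap p (v s)) ?N) = 0"
    using vS N by (intro sum.neutral ballI emeasure_uniform_cap_disjoint) blast+
  finally have "emeasure (cap_mixture p v) ?N = 0" by simp
  then show ?thesis using N by (intro AE_I[where N = ?N]) auto
qed

text \<open>Tonelli: almost every first point lies in some cap, and then the section over it has
  mass at most \<open>1 / (p + 1)\<close>. That the mixture is a probability measure makes the
  integral of this constant equal to the constant.\<close>

lemma cap_mixture_pair_not_near_obtuse:
  assumes v: "regular_simplex p v" and P: "prob_space (cap_mixture p v)"
  shows "measure (cap_mixture p v \<Otimes>\<^sub>M cap_mixture p v)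
    {z \<in> space (borel_vec p \<Otimes>\<^sub>M borel_vec p). \<not> near_obtuse p (fst z) (snd z)} \<le> 1 / real (p + 1)"
    (is "measure (?\<mu> \<Otimes>\<^sub>M ?\<mu>) ?B \<le> _")
proof -
  interpret prob_space ?\<mu> by fact
  have "sets (?\<mu> \<Otimes>\<^sub>M ?\<mu>) = sets (borel_vec p \<Otimes>\<^sub>M borel_vec p)"
    by (intro sets_pair_measure_cong) simp_all
  moreover have "?B \<in> sets (borel_vec p \<Otimes>\<^sub>M borel_vec p)" by measurable
  ultimately have B: "?B \<in> sets (?\<mu> \<Otimes>\<^sub>M ?\<mu>)" by simp
  have "emeasure (?\<mu> \<Otimes>\<^sub>M ?\<mu>) ?B = (\<integral>\<^sup>+x. emeasure ?\<mu> (Pair x -` ?B) \<partial>?\<mu>)"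
    by (rule emeasure_pair_measure_alt) fact
  also have "\<dots> \<le> (\<integral>\<^sup>+x. 1 / of_nat (p + 1) \<partial>?\<mu>)"
  proof (rule nn_integral_mono_AE, use AE_cap_mixture[OF v] in eventually_elim)
    fix x assume "\<exists>r\<in>{1..p + 1}. x \<in> cap p (v r)"
    then obtain r where r: "r \<in> {1..p + 1}" "x \<in> cap p (v r)" by blast
    then have "x \<in> space (borel_vec p)"
      using unit_sphere_subset_space by (auto simp: cap_def)
    then have "Pair x -` ?B = {y \<in> space (borel_vec p). \<not> near_obtuse p x y}"
      by (auto simp: space_pair_measure)
    with cap_mixture_not_near_obtuse[OF v r] show "emeasure ?\<mu> (Pair x -` ?B) \<le> 1 / of_nat (p + 1)"
      by simp
  qed
  also have "\<dots> = ennreal (1 / real (p + 1))"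
    using emeasure_space_1 by (simp add: divide_ennreal[symmetric] ennreal_of_nat_eq_real_of_nat)
  finally show ?thesis
    unfolding measure_def by (rule enn2real_leI[rotated]) simp
qed


section \<open>Central symmetry of the uniform distribution\<close>

text \<open>The restriction keeps the result extensional, hence a point of the product
  space.\<close>

definition neg_vec :: "nat \<Rightarrow> (nat \<Rightarrow> real) \<Rightarrow> (nat \<Rightarrow> real)" where
  "neg_vec p x = (\<lambda>i\<in>{..<p}. - x i)"

lemma measurable_neg_vec [measurable]: "neg_vec p \<in> borel_vec p \<rightarrow>\<^sub>M borel_vec p"
  unfolding neg_vec_def by measurable

lemma measurable_normalize_vec [measurable]: "normalize_vec p \<in> borel_vec p \<rightarrow>\<^sub>M borel_vec p"
  unfolding normalize_vec_def by measurable

lemma L2_set_neg_vec [simp]: "L2_set (neg_vec p x) {..<p} = L2_set x {..<p}"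
  by (simp add: neg_vec_def L2_set_def)

lemma dot_normalize_neg_vec: "dot p x (normalize_vec p (neg_vec p y)) = - dot p x (normalize_vec p y)"
  unfolding dot_def sum_negf[symmetric]
  by (intro sum.cong refl) (simp add: normalize_vec_def L2_set_neg_vec[unfolded neg_vec_def] neg_vec_def)

lemma emeasure_lborel_uminus:
  assumes "A \<in> sets borel"
  shows "emeasure lborel (uminus -` A) = emeasure lborel (A :: real set)"
proof -
  have "emeasure lborel A = emeasure (distr lborel borel uminus) A"
    by (simp add: lborel_distr_uminus)
  also have "\<dots> = emeasure lborel (uminus -` A)"
    using assms by (subst emeasure_distr) auto
  finally show ?thesis by simp
qed

text \<open>The product measure is determined by its values on boxes. A box is reflected factor by
  factor, and \<open>lborel\<close> is invariant under \<open>uminus\<close>.\<close>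

lemma distr_lebesgue_vec_neg_vec:
  "distr (lebesgue_vec p) (borel_vec p) (neg_vec p) = lebesgue_vec p"
proof -
  interpret product_sigma_finite "\<lambda>_::nat. lborel :: real measure"
    by standard
  show ?thesis
  proof (rule PiM_eqI)
    fix A :: "nat \<Rightarrow> real set"
    assume A: "\<And>i. i \<in> {..<p} \<Longrightarrow> A i \<in> sets lborel"
    have m: "neg_vec p \<in> lebesgue_vec p \<rightarrow>\<^sub>M borel_vec p"
      using measurable_neg_vec by (simp cong: measurable_cong_sets add: sets_lebesgue_vec)
    have "emeasure (distr (lebesgue_vec p) (borel_vec p) (neg_vec p)) (Pi\<^sub>E {..<p} A)
      = emeasure (lebesgue_vec p) (neg_vec p -` (Pi\<^sub>E {..<p} A) \<inter> space (lebesgue_vec p))"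
      using A by (intro emeasure_distr m sets_PiM_I_finite) auto
    also have "neg_vec p -` (Pi\<^sub>E {..<p} A) \<inter> space (lebesgue_vec p)
      = Pi\<^sub>E {..<p} (\<lambda>i. uminus -` A i)"
      by (auto simp: neg_vec_def space_PiM PiE_iff)
    also have "emeasure (lebesgue_vec p) \<dots> = (\<Prod>i<p. emeasure lborel (uminus -` A i))"
      using A by (intro emeasure_PiM) (auto intro!: measurable_sets_borel[of uminus borel, simplified])
    also have "\<dots> = (\<Prod>i<p. emeasure lborel (A i))"
      using A by (intro prod.cong refl emeasure_lborel_uminus) auto
    finally show "emeasure (distr (lebesgue_vec p) (borel_vec p) (neg_vec p)) (Pi\<^sub>E {..<p} A)
      = (\<Prod>i<p. emeasure lborel (A i))" .
  qed (simp_all add: sets_lebesgue_vec)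
qed

text \<open>Negation preserves Lebesgue measure and the ball, commutes with normalization, and so
  exchanges the cones over the two open half-spaces bounded by the hyperplane orthogonal to
  \<open>x\<close>.\<close>

lemma emeasure_uniform_sphere_symmetric:
  assumes [measurable]: "x \<in> space (borel_vec p)"
  shows "emeasure (uniform_sphere p) {y \<in> space (borel_vec p). dot p x y < 0}
    = emeasure (uniform_sphere p) {y \<in> space (borel_vec p). dot p x y > 0}"
proof -
  note [simp] = sets_lebesgue_vec
  have space [simp]: "space (lebesgue_vec p) = space (borel_vec p)"
    by (rule sets_eq_imp_space_eq) simp
  note [measurable_cong] = sets_lebesgue_vec
  \<comment> \<open>The part of the ball that normalization sends into \<open>A\<close>; its share
    of the ball's volume is the mass of \<open>A\<close>.\<close>
  let ?cone = "\<lambda>A. unit_ball p \<inter> (normalize_vec p -` A \<inter> space (borel_vec p))"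
  have cone: "emeasure (uniform_sphere p) A
      = emeasure (lebesgue_vec p) (?cone A) / emeasure (lebesgue_vec p) (unit_ball p)"
    and cone_sets: "?cone A \<in> sets (borel_vec p)"
    if A: "A \<in> sets (borel_vec p)" for A
  proof -
    have N: "normalize_vec p -` A \<inter> space (borel_vec p) \<in> sets (borel_vec p)"
      using measurable_normalize_vec A by (rule measurable_sets)
    then show "?cone A \<in> sets (borel_vec p)" using sets_unit_ball by blast
    have "normalize_vec p \<in> uniform_measure (lebesgue_vec p) (unit_ball p) \<rightarrow>\<^sub>M borel_vec p"
      using measurable_normalize_vec by (simp cong: measurable_cong_sets)
    then show "emeasure (uniform_sphere p) A
        = emeasure (lebesgue_vec p) (?cone A) / emeasure (lebesgue_vec p) (unit_ball p)"
      unfolding uniform_sphere_def using A N sets_unit_ball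
      by (subst emeasure_distr) auto
  qed
  let ?neg = "{y \<in> space (borel_vec p). dot p x y < 0}"
    and ?pos = "{y \<in> space (borel_vec p). dot p x y > 0}"
  have sets: "?neg \<in> sets (borel_vec p)" "?pos \<in> sets (borel_vec p)"
    by measurable
  have "emeasure (lebesgue_vec p) (?cone ?pos)
    = emeasure (distr (lebesgue_vec p) (borel_vec p) (neg_vec p)) (?cone ?pos)"
    by (simp only: distr_lebesgue_vec_neg_vec)
  also have "\<dots> = emeasure (lebesgue_vec p) (neg_vec p -` ?cone ?pos \<inter> space (borel_vec p))"
    using cone_sets[OF sets(2)] measurable_neg_vec
    by (subst emeasure_distr) (simp_all cong: measurable_cong_sets)
  also have "neg_vec p -` ?cone ?pos \<inter> space (borel_vec p) = ?cone ?neg"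
    using measurable_space[OF measurable_neg_vec, of _ p] measurable_space[OF measurable_normalize_vec, of _ p]
    by (auto simp: unit_ball_def dot_normalize_neg_vec)
  finally show ?thesis
    using sets by (simp add: cone)
qed

lemma emeasure_uniform_sphere_le_1: "emeasure (uniform_sphere p) A \<le> 1"
proof (cases "A \<in> sets (borel_vec p)")
  case True
  have "normalize_vec p \<in> uniform_measure (lebesgue_vec p) (unit_ball p) \<rightarrow>\<^sub>M borel_vec p"
    using measurable_normalize_vec by (simp cong: measurable_cong_sets add: sets_lebesgue_vec)
  with True show ?thesis
    unfolding uniform_sphere_def
    by (simp add: emeasure_distr emeasure_uniform_measure_le_1 sets_unit_ball sets_lebesgue_vec)
qed (simp add: emeasure_notin_sets)

lemma finite_measure_uniform_sphere: "finite_measure (uniform_sphere p)"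
  using emeasure_uniform_sphere_le_1[of p "space (uniform_sphere p)"]
  by (intro finite_measureI) (auto simp: top_unique)

lemma space_uniform_sphere [simp]: "space (uniform_sphere p) = space (borel_vec p)"
  by (rule sets_eq_imp_space_eq) simp

lemma emeasure_uniform_sphere_pair_le_1: "emeasure (uniform_sphere p \<Otimes>\<^sub>M uniform_sphere p) A \<le> 1"
proof -
  interpret finite_measure "uniform_sphere p" by (rule finite_measure_uniform_sphere)
  let ?S = "space (uniform_sphere p)"
  have "emeasure (uniform_sphere p \<Otimes>\<^sub>M uniform_sphere p) A
      \<le> emeasure (uniform_sphere p \<Otimes>\<^sub>M uniform_sphere p) (?S \<times> ?S)"
    using emeasure_space[of "uniform_sphere p \<Otimes>\<^sub>M uniform_sphere p" A] by (simp add: space_pair_measure)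
  also have "\<dots> = emeasure (uniform_sphere p) ?S * emeasure (uniform_sphere p) ?S"
    by (rule emeasure_pair_measure_Times) auto
  also have "\<dots> \<le> 1 * 1"
    by (intro mult_mono emeasure_uniform_sphere_le_1) auto
  finally show ?thesis by simp
qed

lemma measure_uniform_sphere_pair_le_1: "measure (uniform_sphere p \<Otimes>\<^sub>M uniform_sphere p) A \<le> 1"
  unfolding measure_def using emeasure_uniform_sphere_pair_le_1[of p A] by (intro enn2real_leI) auto

text \<open>The events of negative and of positive inner product are disjoint and, by symmetry in
  the second point, equally likely. Their total is at most 1, so neither exceeds one half.\<close>

lemma measure_uniform_sphere_pair_dot_neg:
  "measure (uniform_sphere p \<Otimes>\<^sub>M uniform_sphere p)
     {z \<in> space (borel_vec p \<Otimes>\<^sub>M borel_vec p). dot p (fst z) (snd z) < 0} \<le> 1 / 2"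
proof -
  let ?U = "uniform_sphere p" and ?S = "space (borel_vec p \<Otimes>\<^sub>M borel_vec p)"
  let ?neg = "{z \<in> ?S. dot p (fst z) (snd z) < 0}" and ?pos = "{z \<in> ?S. dot p (fst z) (snd z) > 0}"
  interpret finite_measure ?U by (rule finite_measure_uniform_sphere)
  have [simp]: "sets (?U \<Otimes>\<^sub>M ?U) = sets (borel_vec p \<Otimes>\<^sub>M borel_vec p)"
    by (intro sets_pair_measure_cong) simp_all
  have sets: "?neg \<in> sets (?U \<Otimes>\<^sub>M ?U)" "?pos \<in> sets (?U \<Otimes>\<^sub>M ?U)"
    by simp_all measurable
  have "emeasure (?U \<Otimes>\<^sub>M ?U) ?neg = emeasure (?U \<Otimes>\<^sub>M ?U) ?pos"
    unfolding emeasure_pair_measure_alt[OF sets(1)] emeasure_pair_measure_alt[OF sets(2)]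
  proof (rule nn_integral_cong)
    fix x assume "x \<in> space ?U"
    then have x: "x \<in> space (borel_vec p)" by simp
    then have "Pair x -` ?neg = {y \<in> space (borel_vec p). dot p x y < 0}"
      "Pair x -` ?pos = {y \<in> space (borel_vec p). dot p x y > 0}"
      by (auto simp: space_pair_measure)
    then show "emeasure ?U (Pair x -` ?neg) = emeasure ?U (Pair x -` ?pos)"
      using emeasure_uniform_sphere_symmetric[OF x] by simp
  qed
  then have "measure (?U \<Otimes>\<^sub>M ?U) ?neg = measure (?U \<Otimes>\<^sub>M ?U) ?pos"
    by (simp add: measure_def)
  moreover have "measure (?U \<Otimes>\<^sub>M ?U) (?neg \<union> ?pos) = measure (?U \<Otimes>\<^sub>M ?U) ?neg + measure (?U \<Otimes>\<^sub>M ?U) ?pos"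
    using emeasure_uniform_sphere_pair_le_1[of p ?neg] emeasure_uniform_sphere_pair_le_1[of p ?pos]
    by (intro measure_Union sets) (auto simp: top_unique)
  ultimately show ?thesis
    using measure_uniform_sphere_pair_le_1[of p "?neg \<union> ?pos"] by linarith
qed

section \<open>Lower bound for the distance to the uniform distribution\<close>

lemma dot_dist_cap_mixture_ge:
  assumes p: "p \<ge> 1" and v: "regular_simplex p v" and P: "prob_space (cap_mixture p v)"
  shows "dot_dist p (cap_mixture p v) (uniform_sphere p) \<ge> 1 / 2 - 1 / real (p + 1)"
proof -
  let ?\<mu> = "cap_mixture p v \<Otimes>\<^sub>M cap_mixture p v" and ?\<nu> = "uniform_sphere p \<Otimes>\<^sub>M uniform_sphere p"
  let ?S = "space (borel_vec p \<Otimes>\<^sub>M borel_vec p)"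
  let ?D = "\<lambda>t. {z \<in> ?S. dot p (fst z) (snd z) \<le> t}"
  interpret \<mu>: prob_space "cap_mixture p v" by fact
  interpret pair_prob_space "cap_mixture p v" "cap_mixture p v" ..
  have [simp]: "sets ?\<mu> = sets (borel_vec p \<Otimes>\<^sub>M borel_vec p)" "sets ?\<nu> = sets (borel_vec p \<Otimes>\<^sub>M borel_vec p)"
    by (intro sets_pair_measure_cong; simp)+
  have [simp]: "space ?\<mu> = ?S" "space ?\<nu> = ?S"
    by (intro sets_eq_imp_space_eq; simp)+
  \<comment> \<open>The upper end of the \<open>near_obtuse\<close> interval, so the event
    \<open>?D ?t\<close> contains every near-obtuse pair; it is also negative, so the symmetry bound
    applies to the uniform side.\<close>
  let ?t = "- 1 / (2 * real p)"
  let ?f = "\<lambda>t. \<bar>measure ?\<mu> (?D t) - measure ?\<nu> (?D t)\<bar>"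
  let ?B = "{z \<in> ?S. \<not> near_obtuse p (fst z) (snd z)}"
  have B: "?B \<in> sets ?\<mu>" by simp measurable
  have D: "?D t \<in> sets ?\<mu>" for t by simp measurable
  have "1 - 1 / real (p + 1) \<le> 1 - measure ?\<mu> ?B"
    using cap_mixture_pair_not_near_obtuse[OF v P] by linarith
  also have "\<dots> = measure ?\<mu> (?S - ?B)"
    using P.prob_compl[OF B] by simp
  also have "\<dots> \<le> measure ?\<mu> (?D ?t)"
    by (intro P.finite_measure_mono D) (auto simp: near_obtuse_def)
  finally have 1: "1 - 1 / real (p + 1) \<le> measure ?\<mu> (?D ?t)" .
  have t: "?t < 0" "?t \<in> {-1..1}" using p by (auto simp: field_simps)
  let ?N = "{z \<in> ?S. dot p (fst z) (snd z) < 0}"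
  have N: "?N \<in> sets ?\<nu>" by simp measurable
  have "?D ?t \<subseteq> ?N" using le_less_trans[OF _ t(1)] by blast
  \<comment> \<open>The uniform product is known here only to have mass at most 1, so monotonicity
    goes through finite measurability of the larger set.\<close>
  then have "measure ?\<nu> (?D ?t) \<le> measure ?\<nu> ?N"
    using N emeasure_uniform_sphere_pair_le_1[of p ?N]
    by (intro measure_mono_fmeasurable) (auto simp: fmeasurable_def D[simplified] less_top[symmetric] top_unique)
  also have "\<dots> \<le> 1 / 2" by (rule measure_uniform_sphere_pair_dot_neg)
  finally have "1 / 2 - 1 / real (p + 1) \<le> ?f ?t" using 1 by linarith
  also have "\<dots> \<le> (SUP t\<in>{-1..1}. ?f t)"
  \<comment> \<open>A real supremum dominates its members only over a set bounded above; differences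
    of numbers in \<open>[0, 1]\<close> are bounded by 1.\<close>
  proof (rule cSUP_upper[OF t(2)], rule bdd_aboveI2)
    fix t
    have "0 \<le> measure ?\<mu> (?D t)" "measure ?\<mu> (?D t) \<le> 1" "0 \<le> measure ?\<nu> (?D t)" "measure ?\<nu> (?D t) \<le> 1"
      using measure_uniform_sphere_pair_le_1[of p "?D t"] by auto
    then show "?f t \<le> 1" by linarith
  qed
  finally show ?thesis by (simp add: dot_dist_def)
qed

section \<open>The sample\<close>

lemma finite_pairs [simp]: "finite (pairs n)"
  by (rule finite_subset[of _ "{..n} \<times> {..n}"]) (auto simp: pairs_def)

text \<open>Passing to \<open>Suc n\<close> adds the \<open>n\<close> pairs whose larger index is
  \<open>Suc n\<close>. The factor 2 avoids integer division, and truncated subtraction is harmless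
  at \<open>n = 0\<close>.\<close>

lemma card_pairs: "2 * card (pairs n) = n * (n - 1)"
proof (induction n)
  case 0
  have "pairs 0 = {}" by (auto simp: pairs_def)
  then show ?case by simp
next
  case (Suc n)
  have "pairs (Suc n) = pairs n \<union> (\<lambda>i. (i, Suc n)) ` {1..n}"
    by (auto simp: pairs_def)
  moreover have "card ((\<lambda>i. (i, Suc n)) ` {1..n}) = n"
    by (subst card_image) (auto simp: inj_on_def)
  moreover have "pairs n \<inter> (\<lambda>i. (i, Suc n)) ` {1..n} = {}"
    by (auto simp: pairs_def)
  ultimately have "card (pairs (Suc n)) = card (pairs n) + n"
    by (simp add: card_Un_disjoint)
  with Suc show ?case by (cases n) auto
qed

lemma real_card_pairs: "real (card (pairs n)) = real n * (real n - 1) / 2"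
proof -
  have "real (2 * card (pairs n)) = real (n * (n - 1))" by (simp only: card_pairs)
  then show ?thesis by (cases n) (auto simp: algebra_simps)
qed

text \<open>Points in pairwise distinct caps satisfy this. Stating it through inner products makes
  its measurability immediate and suits the bounds on the statistics.\<close>

definition all_obtuse :: "nat \<Rightarrow> nat \<Rightarrow> (nat \<Rightarrow> nat \<Rightarrow> real) \<Rightarrow> bool" where
  "all_obtuse p n x \<longleftrightarrow> (\<forall>(i, j)\<in>pairs n. near_obtuse p (x i) (x j))"

lemma iid_sample_prob_space:
  assumes M: "prob_space M" and iid: "iid_sample M X n \<mu>" and n: "n \<ge> 1"
  shows "prob_space \<mu>"
proof -
  interpret prob_space M by fact
  have "X 1 \<in> M \<rightarrow>\<^sub>M \<mu>" "distr M \<mu> (X 1) = \<mu>"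
    using iid n by (auto simp: iid_sample_def indep_vars_def)
  then show ?thesis using prob_space_distr[of "X 1" \<mu>] by simp
qed

lemma iid_sample_measurable:
  assumes M: "prob_space M" and iid: "iid_sample M X n \<mu>" and i: "i \<in> {1..n}"
  shows "X i \<in> M \<rightarrow>\<^sub>M \<mu>"
  using iid i unfolding iid_sample_def prob_space.indep_vars_def[OF M] by blast

lemma iid_sample_pair_distr:
  assumes M: "prob_space M" and iid: "iid_sample M X n \<mu>" and ij: "i \<in> {1..n}" "j \<in> {1..n}" "i \<noteq> j"
  shows "distr M (\<mu> \<Otimes>\<^sub>M \<mu>) (\<lambda>w. (X i w, X j w)) = \<mu> \<Otimes>\<^sub>M \<mu>"
proof -
  interpret prob_space M by fact
  have "indep_var \<mu> (X i) \<mu> (X j)"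
  proof -
    have "indep_vars (\<lambda>_. \<mu>) X {1..n}" using iid by (simp add: iid_sample_def)
    \<comment> \<open>Restrictions of the family to the disjoint blocks \<open>{i}\<close> and
      \<open>{j}\<close> are independent; evaluation at the single index recovers the two
      variables.\<close>
    then have "indep_var \<mu> ((\<lambda>f. f i) \<circ> (\<lambda>w. restrict (\<lambda>k. X k w) {i})) \<mu> ((\<lambda>f. f j) \<circ> (\<lambda>w. restrict (\<lambda>k. X k w) {j}))"
      using ij by (intro indep_var_compose[OF indep_var_restrict]) auto
    then show ?thesis by (simp add: comp_def)
  qed
  then show ?thesis
    using iid ij by (auto simp: indep_var_distribution_eq iid_sample_def)
qed

lemma iid_cap_mixture_measurable:
  assumes "prob_space M" "iid_sample M X n (cap_mixture p v)" "i \<in> {1..n}"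
  shows "X i \<in> M \<rightarrow>\<^sub>M borel_vec p"
  using iid_sample_measurable[OF assms] by (simp cong: measurable_cong_sets)

lemma sets_all_obtuse:
  assumes "prob_space M" "iid_sample M X n (cap_mixture p v)"
  shows "{w \<in> space M. all_obtuse p n (\<lambda>i. X i w)} \<in> sets M"
proof -
  have "{w \<in> space M. near_obtuse p (X i w) (X j w)} \<in> sets M" if "(i, j) \<in> pairs n" for i j
  proof -
    have [measurable]: "X i \<in> M \<rightarrow>\<^sub>M borel_vec p" "X j \<in> M \<rightarrow>\<^sub>M borel_vec p"
      using that by (auto intro!: iid_cap_mixture_measurable[OF assms] simp: pairs_def)
    show ?thesis by measurable
  qed
  then show ?thesis
    unfolding all_obtuse_def by (intro sets.sets_Collect_finite_All) (auto split: prod.splits)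
qed

text \<open>Union bound over the \<open>n * (n - 1) / 2\<close> pairs, each failing with probability
  at most \<open>1 / (p + 1)\<close>. The result is rounded up to the reciprocal of the ratio in the
  growth condition.\<close>

lemma prob_all_obtuse:
  assumes M: "prob_space M" and iid: "iid_sample M X n (cap_mixture p v)"
    and v: "regular_simplex p v" and n: "n \<ge> 1" and p: "p \<ge> 1"
  shows "measure M {w \<in> space M. all_obtuse p n (\<lambda>i. X i w)} \<ge> 1 - (real n)\<^sup>2 / real p"
proof -
  interpret prob_space M by fact
  let ?\<mu> = "cap_mixture p v"
  let ?G = "{w \<in> space M. all_obtuse p n (\<lambda>i. X i w)}"
  let ?B = "{z \<in> space (borel_vec p \<Otimes>\<^sub>M borel_vec p). \<not> near_obtuse p (fst z) (snd z)}"
  let ?E = "\<lambda>(i, j). (\<lambda>w. (X i w, X j w)) -` ?B \<inter> space M"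
  have B: "?B \<in> sets (borel_vec p \<Otimes>\<^sub>M borel_vec p)" by measurable
  have sets: "sets (?\<mu> \<Otimes>\<^sub>M ?\<mu>) = sets (borel_vec p \<Otimes>\<^sub>M borel_vec p)"
    by (intro sets_pair_measure_cong) simp_all
  have E: "?E ij \<in> events" "prob (?E ij) \<le> 1 / real (p + 1)" if "ij \<in> pairs n" for ij
  proof -
    obtain i j where ij: "ij = (i, j)" by fastforce
    then have [measurable]: "X i \<in> M \<rightarrow>\<^sub>M borel_vec p" "X j \<in> M \<rightarrow>\<^sub>M borel_vec p"
      using that by (auto intro!: iid_cap_mixture_measurable[OF M iid] simp: pairs_def)
    have m: "(\<lambda>w. (X i w, X j w)) \<in> M \<rightarrow>\<^sub>M borel_vec p \<Otimes>\<^sub>M borel_vec p" by measurable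
    show "?E ij \<in> events" using measurable_sets[OF m B] ij by simp
    have "prob (?E ij) = measure (distr M (?\<mu> \<Otimes>\<^sub>M ?\<mu>) (\<lambda>w. (X i w, X j w))) ?B"
      using m B ij by (subst measure_distr) (simp_all add: sets cong: measurable_cong_sets)
    also have "\<dots> = measure (?\<mu> \<Otimes>\<^sub>M ?\<mu>) ?B"
      using that ij by (subst iid_sample_pair_distr[OF M iid]) (auto simp: pairs_def)
    finally show "prob (?E ij) \<le> 1 / real (p + 1)"
      using cap_mixture_pair_not_near_obtuse[OF v iid_sample_prob_space[OF M iid n]] by simp
  qed
  have "space M - ?G \<subseteq> (\<Union>ij\<in>pairs n. ?E ij)"
  proof
    fix w assume "w \<in> space M - ?G"
    then obtain i j where ij: "(i, j) \<in> pairs n" "\<not> near_obtuse p (X i w) (X j w)" "w \<in> space M"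
      by (auto simp: all_obtuse_def)
    then have "X i w \<in> space (borel_vec p)" "X j w \<in> space (borel_vec p)"
      by (auto intro!: measurable_space[OF iid_cap_mixture_measurable[OF M iid]] simp: pairs_def)
    with ij show "w \<in> (\<Union>ij\<in>pairs n. ?E ij)"
      by (auto simp: space_pair_measure intro!: bexI[of _ "(i, j)"])
  qed
  then have "prob (space M - ?G) \<le> prob (\<Union>ij\<in>pairs n. ?E ij)"
    using E by (intro finite_measure_mono sets.finite_UN) auto
  also have "\<dots> \<le> (\<Sum>ij\<in>pairs n. prob (?E ij))"
    using E by (intro finite_measure_subadditive_finite) auto
  also have "\<dots> \<le> (\<Sum>ij\<in>pairs n. 1 / real (p + 1))"
    by (intro sum_mono E)
  also have "\<dots> = (real n * (real n - 1) / 2) * (1 / real (p + 1))"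
    by (simp add: real_card_pairs)
  also have "\<dots> \<le> (real n)\<^sup>2 * (1 / real p)"
    using p n by (intro mult_mono frac_le) (auto simp: power2_eq_square)
  finally show ?thesis
    using prob_compl[OF sets_all_obtuse[OF M iid]] by simp
qed

section \<open>Deterministic bounds on the three statistics\<close>

lemma R_stat_all_obtuse:
  assumes "all_obtuse p n x" "n \<ge> 1" "p \<ge> 1"
  shows "\<bar>R_stat p n x\<bar> \<le> 3 * sqrt ((real n)\<^sup>2 / real p)"
proof -
  have "\<bar>\<Sum>(i, j)\<in>pairs n. dot p (x i) (x j)\<bar> \<le> (\<Sum>(i, j)\<in>pairs n. \<bar>dot p (x i) (x j)\<bar>)"
    by (rule order_trans[OF sum_abs]) (simp add: case_prod_beta)
  also have "\<dots> \<le> (\<Sum>ij\<in>pairs n. 3 / (2 * real p))"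
    using assms(1) by (intro sum_mono) (auto simp: all_obtuse_def intro!: near_obtuse_bounds)
  also have "\<dots> = (real n * (real n - 1) / 2) * (3 / (2 * real p))"
    by (simp add: real_card_pairs)
  also have "\<dots> \<le> (real n * real n / 2) * (3 / (2 * real p))"
    by (intro mult_right_mono divide_right_mono mult_left_mono) auto
  finally have "\<bar>R_stat p n x\<bar> \<le> sqrt (2 * real p) / real n * ((real n * real n / 2) * (3 / (2 * real p)))"
    unfolding R_stat_def abs_mult by (intro mult_mono) auto
  \<comment> \<open>At most \<open>n * n / 2\<close> terms of size \<open>3 / (2 * p)\<close>, times
    the prefactor, have order \<open>n / sqrt p\<close>; the constant is then rounded up to
    3.\<close>
  also have "\<dots> = 3 / 4 * sqrt 2 * (real n * (sqrt (real p) / real p))"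
    using assms by (simp add: real_sqrt_mult field_simps)
  also have "\<dots> \<le> 3 * (real n * (sqrt (real p) / real p))"
    using sqrt2_less_2 by (intro mult_right_mono) auto
  also have "real n * (sqrt (real p) / real p) = sqrt ((real n)\<^sup>2 / real p)"
    using assms by (simp add: real_sqrt_divide sqrt_divide_self_eq inverse_eq_divide)
  finally show ?thesis .
qed

text \<open>Squared inner products have order \<open>1 / p^2\<close>, so the centring
  \<open>1 / p\<close> dominates: each summand is at most \<open>- 1 / (4 * p)\<close>, and summing
  over all pairs leaves a bound linear in \<open>n\<close>.\<close>

lemma B_stat_all_obtuse:
  assumes "all_obtuse p n x" "n \<ge> 1" "p \<ge> 3"
  shows "B_stat p n x \<le> - (real n - 1) / 8"
proof -
  have "(\<Sum>(i, j)\<in>pairs n. (dot p (x i) (x j))\<^sup>2 - 1 / real p) \<le> (\<Sum>ij\<in>pairs n. - 1 / (4 * real p))"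
  proof (rule sum_mono)
    fix ij assume "ij \<in> pairs n"
    then have "(dot p (x (fst ij)) (x (snd ij)))\<^sup>2 \<le> 9 / (4 * (real p)\<^sup>2)"
      using assms(1) by (intro near_obtuse_bounds) (auto simp: all_obtuse_def)
    \<comment> \<open>The right side is \<open>3 / (4 * p)\<close>, so this inequality amounts to
      \<open>p \<ge> 3\<close>.\<close>
    also have "\<dots> \<le> 1 / real p - 1 / (4 * real p)"
      using assms(3) by (simp add: field_simps power2_eq_square)
    finally show "(case ij of (i, j) \<Rightarrow> (dot p (x i) (x j))\<^sup>2 - 1 / real p) \<le> - 1 / (4 * real p)"
      by (simp add: case_prod_beta)
  qed
  also have "\<dots> = (real n * (real n - 1) / 2) * (- 1 / (4 * real p))"
    by (simp add: real_card_pairs)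
  finally have "B_stat p n x \<le> real p / real n * ((real n * (real n - 1) / 2) * (- 1 / (4 * real p)))"
    unfolding B_stat_def by (intro mult_left_mono) auto
  also have "\<dots> = - (real n - 1) / 8"
    using assms by (simp add: field_simps)
  finally show ?thesis .
qed

lemma P_stat_all_obtuse:
  assumes "all_obtuse p n x" "n \<ge> 2" "p \<ge> 3"
  shows "P_stat p n x \<le> 1 - 4 * ln (real n) + ln (ln (real n))"
proof -
  \<comment> \<open>The maximum must range over a nonempty set for \<open>Max_le_iff\<close>, which
    is where \<open>n \<ge> 2\<close> enters.\<close>
  have "(1, 2) \<in> pairs n" using assms(2) by (auto simp: pairs_def)
  then have "(MAX (i, j)\<in>pairs n. (dot p (x i) (x j))\<^sup>2) \<le> 9 / (4 * (real p)\<^sup>2)"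
    using assms(1) by (subst Max_le_iff) (auto simp: all_obtuse_def intro!: near_obtuse_bounds)
  then have "real p * (MAX (i, j)\<in>pairs n. (dot p (x i) (x j))\<^sup>2) \<le> real p * (9 / (4 * (real p)\<^sup>2))"
    by (intro mult_left_mono) auto
  also have "\<dots> \<le> 1"
    using assms(3) by (simp add: field_simps power2_eq_square)
  finally show ?thesis by (simp add: P_stat_def)
qed

section \<open>Measurability of the statistics and criteria for limits in probability\<close>

lemma measurable_B_stat:
  assumes "\<And>i. i \<in> {1..n} \<Longrightarrow> X i \<in> M \<rightarrow>\<^sub>M borel_vec p"
  shows "(\<lambda>w. B_stat p n (\<lambda>i. X i w)) \<in> borel_measurable M"
proof -
  have "(\<lambda>w. dot p (X i w) (X j w)) \<in> borel_measurable M" if "(i, j) \<in> pairs n" for i j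
    using that by (intro measurable_dot assms) (auto simp: pairs_def)
  then show ?thesis
    unfolding B_stat_def case_prod_beta
    by (intro borel_measurable_times borel_measurable_sum borel_measurable_diff borel_measurable_power) auto
qed

lemma measurable_P_stat:
  assumes "\<And>i. i \<in> {1..n} \<Longrightarrow> X i \<in> M \<rightarrow>\<^sub>M borel_vec p"
  shows "(\<lambda>w. P_stat p n (\<lambda>i. X i w)) \<in> borel_measurable M"
proof -
  have "(\<lambda>w. dot p (X i w) (X j w)) \<in> borel_measurable M" if "(i, j) \<in> pairs n" for i j
    using that by (intro measurable_dot assms) (auto simp: pairs_def)
  then show ?thesis
    unfolding P_stat_def case_prod_beta
    by (intro borel_measurable_times borel_measurable_add borel_measurable_diff borel_measurable_power
        borel_measurable_Max) auto
qed

text \<open>Once \<open>b n < - K\<close>, the event \<open>G n\<close> is contained in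
  \<open>Z n w < - K\<close>. Monotonicity asks for measurability of the larger event, hence the
  hypothesis on \<open>Z\<close>.\<close>

lemma diverges_to_minus_infinityI:
  fixes Z :: "nat \<Rightarrow> 'w \<Rightarrow> real"
  assumes M: "\<And>n. n \<ge> 1 \<Longrightarrow> prob_space (M n)"
    and Z: "\<And>n. n \<ge> 1 \<Longrightarrow> Z n \<in> borel_measurable (M n)"
    and G: "(\<lambda>n. measure (M n) {w \<in> space (M n). G n w}) \<longlonglongrightarrow> 1"
    and ZG: "eventually (\<lambda>n. \<forall>w. G n w \<longrightarrow> Z n w \<le> b n) sequentially"
    and b: "filterlim b at_bot sequentially"
  shows "diverges_to_minus_infinity_in_prob M Z"
  unfolding diverges_to_minus_infinity_in_prob_def
proof (intro allI impI)
  fix K :: real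
  have "eventually (\<lambda>n. b n < - K) sequentially"
    using b by (simp add: filterlim_at_bot_dense)
  with ZG eventually_ge_at_top[of 1]
  have lower: "eventually (\<lambda>n. measure (M n) {w \<in> space (M n). G n w} \<le> \<P>(w in M n. Z n w < - K)) sequentially"
  proof eventually_elim
    case (elim n)
    interpret prob_space "M n" using M elim by blast
    have [measurable]: "Z n \<in> borel_measurable (M n)" using Z elim by blast
    show ?case using elim by (intro finite_measure_mono) force+
  qed
  have upper: "eventually (\<lambda>n. \<P>(w in M n. Z n w < - K) \<le> 1) sequentially"
    using eventually_ge_at_top[of 1] by eventually_elim (use M prob_space.prob_le_1 in blast)
  show "(\<lambda>n. \<P>(w in M n. Z n w < - K)) \<longlonglongrightarrow> 1"
    by (rule tendsto_sandwich[OF lower upper G tendsto_const])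
qed

text \<open>Once \<open>b n < e\<close>, a deviation beyond \<open>e\<close> forces the complement
  of \<open>G n\<close>. That complement is now the larger set, so measurability is asked of
  \<open>G n\<close>.\<close>

lemma converges_in_prob_0I:
  fixes Z :: "nat \<Rightarrow> 'w \<Rightarrow> real"
  assumes M: "\<And>n. n \<ge> 1 \<Longrightarrow> prob_space (M n)"
    and Gs: "\<And>n. n \<ge> 1 \<Longrightarrow> {w \<in> space (M n). G n w} \<in> sets (M n)"
    and G: "(\<lambda>n. measure (M n) {w \<in> space (M n). G n w}) \<longlonglongrightarrow> 1"
    and ZG: "eventually (\<lambda>n. \<forall>w. G n w \<longrightarrow> \<bar>Z n w\<bar> \<le> b n) sequentially"
    and b: "b \<longlonglongrightarrow> 0"
  shows "converges_in_prob M Z 0"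
  unfolding converges_in_prob_def
proof (intro allI impI)
  fix e :: real assume "e > 0"
  then have "eventually (\<lambda>n. b n < e) sequentially"
    using b by (rule order_tendstoD(2)[rotated])
  with ZG eventually_ge_at_top[of 1]
  have upper: "eventually (\<lambda>n. \<P>(w in M n. \<bar>Z n w - 0\<bar> > e)
      \<le> 1 - measure (M n) {w \<in> space (M n). G n w}) sequentially"
  proof eventually_elim
    case (elim n)
    interpret prob_space "M n" using M elim by blast
    have "{w \<in> space (M n). \<bar>Z n w - 0\<bar> > e} \<subseteq> space (M n) - {w \<in> space (M n). G n w}"
      using elim by force
    then have "\<P>(w in M n. \<bar>Z n w - 0\<bar> > e) \<le> prob (space (M n) - {w \<in> space (M n). G n w})"
      using Gs elim by (intro finite_measure_mono) auto
    then show ?case using prob_compl[OF Gs] elim by simp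
  qed
  have lim: "(\<lambda>n. 1 - measure (M n) {w \<in> space (M n). G n w}) \<longlonglongrightarrow> 0"
    using tendsto_diff[OF tendsto_const[of 1] G] by simp
  show "(\<lambda>n. \<P>(w in M n. \<bar>Z n w - 0\<bar> > e)) \<longlonglongrightarrow> 0"
    by (rule tendsto_sandwich[OF _ upper tendsto_const lim]) (simp add: always_eventually)
qed

theorem theorem7:
  fixes p :: "nat \<Rightarrow> nat"
    and v :: "nat \<Rightarrow> nat \<Rightarrow> nat \<Rightarrow> real"
    and M :: "nat \<Rightarrow> 'w measure"
    and X :: "nat \<Rightarrow> nat \<Rightarrow> 'w \<Rightarrow> nat \<Rightarrow> real"
  assumes dim: "\<And>n. n \<ge> 1 \<Longrightarrow> p n \<ge> 3"
    and growth: "filterlim (\<lambda>n. real (p n) / (real n)\<^sup>2) at_top sequentially"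
    and simplex: "\<And>n. n \<ge> 1 \<Longrightarrow> regular_simplex (p n) (v n)"
    and prob: "\<And>n. n \<ge> 1 \<Longrightarrow> prob_space (M n)"
    and iid: "\<And>n. n \<ge> 1 \<Longrightarrow> iid_sample (M n) (X n) n (cap_mixture (p n) (v n))"
  shows "liminf (\<lambda>n. ereal (dot_dist (p n) (cap_mixture (p n) (v n)) (uniform_sphere (p n))))
           \<ge> ereal (1 / 10)
       \<and> converges_in_prob M (\<lambda>n w. R_stat (p n) n (\<lambda>i. X n i w)) 0
       \<and> diverges_to_minus_infinity_in_prob M (\<lambda>n w. B_stat (p n) n (\<lambda>i. X n i w))
       \<and> diverges_to_minus_infinity_in_prob M (\<lambda>n w. P_stat (p n) n (\<lambda>i. X n i w))"
proof -
  \<comment> \<open>The growth condition enters only through this reciprocal, which controls both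
    the probability of the good event and the bound on \<open>R_stat\<close>.\<close>
  have ratio: "(\<lambda>n. (real n)\<^sup>2 / real (p n)) \<longlonglongrightarrow> 0"
    using tendsto_inverse_0_at_top[OF growth] by simp
  let ?G = "\<lambda>n w. all_obtuse (p n) n (\<lambda>i. X n i w)"
  have p1: "p n \<ge> 1" if "n \<ge> 1" for n using dim[OF that] by simp
  have G: "(\<lambda>n. measure (M n) {w \<in> space (M n). ?G n w}) \<longlonglongrightarrow> 1"
  proof (rule tendsto_sandwich)
    show "\<forall>\<^sub>F n in sequentially. 1 - (real n)\<^sup>2 / real (p n) \<le> measure (M n) {w \<in> space (M n). ?G n w}"
      using eventually_ge_at_top[of 1]
      by eventually_elim (rule prob_all_obtuse[OF prob iid simplex _ p1])
    show "\<forall>\<^sub>F n in sequentially. measure (M n) {w \<in> space (M n). ?G n w} \<le> 1"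
      using eventually_ge_at_top[of 1] by eventually_elim (use prob prob_space.prob_le_1 in blast)
    show "(\<lambda>n. 1 - (real n)\<^sup>2 / real (p n)) \<longlonglongrightarrow> 1"
      using tendsto_diff[OF tendsto_const[of 1] ratio] by simp
  qed simp
  have X: "X n i \<in> M n \<rightarrow>\<^sub>M borel_vec (p n)" if "n \<ge> 1" "i \<in> {1..n}" for n i
    using iid_cap_mixture_measurable[OF prob iid] that by blast
  have "liminf (\<lambda>n. ereal (dot_dist (p n) (cap_mixture (p n) (v n)) (uniform_sphere (p n)))) \<ge> ereal (1 / 10)"
  proof (rule Liminf_bounded, use eventually_ge_at_top[of 1] in eventually_elim)
    fix n :: nat assume n: "1 \<le> n"
    \<comment> \<open>With \<open>p n \<ge> 3\<close> the distance is at least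
      \<open>1 / 2 - 1 / 4\<close>, which exceeds \<open>1 / 10\<close> for every
      \<open>n \<ge> 1\<close>.\<close>
    have "1 / real (p n + 1) \<le> 1 / 4" using dim[OF n] by (intro frac_le) auto
    then have "1 / 10 \<le> dot_dist (p n) (cap_mixture (p n) (v n)) (uniform_sphere (p n))"
      using dot_dist_cap_mixture_ge[OF p1 simplex iid_sample_prob_space[OF prob iid], OF n n n n n]
      by linarith
    then show "ereal (1 / 10) \<le> ereal (dot_dist (p n) (cap_mixture (p n) (v n)) (uniform_sphere (p n)))" by simp
  qed
  moreover have "converges_in_prob M (\<lambda>n w. R_stat (p n) n (\<lambda>i. X n i w)) 0"
  proof (rule converges_in_prob_0I[OF prob _ G])
    show "\<forall>\<^sub>F n in sequentially. \<forall>w. ?G n w \<longrightarrow>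
        \<bar>R_stat (p n) n (\<lambda>i. X n i w)\<bar> \<le> 3 * sqrt ((real n)\<^sup>2 / real (p n))"
      using eventually_ge_at_top[of 1] by eventually_elim (use R_stat_all_obtuse p1 in blast)
    show "(\<lambda>n. 3 * sqrt ((real n)\<^sup>2 / real (p n))) \<longlonglongrightarrow> 0"
      using tendsto_mult_right_zero[OF tendsto_real_sqrt[OF ratio, simplified]] by simp
  qed (use sets_all_obtuse[OF prob iid] in auto)
  moreover have "diverges_to_minus_infinity_in_prob M (\<lambda>n w. B_stat (p n) n (\<lambda>i. X n i w))"
  proof (rule diverges_to_minus_infinityI[OF prob _ G])
    show "\<forall>\<^sub>F n in sequentially. \<forall>w. ?G n w \<longrightarrow> B_stat (p n) n (\<lambda>i. X n i w) \<le> - (real n - 1) / 8"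
      using eventually_ge_at_top[of 1] by eventually_elim (use B_stat_all_obtuse dim in blast)
    show "filterlim (\<lambda>n. - (real n - 1) / 8) at_bot sequentially" by real_asymp
  qed (use X in \<open>auto intro!: measurable_B_stat\<close>)
  moreover have "diverges_to_minus_infinity_in_prob M (\<lambda>n w. P_stat (p n) n (\<lambda>i. X n i w))"
  proof (rule diverges_to_minus_infinityI[OF prob _ G])
    show "\<forall>\<^sub>F n in sequentially. \<forall>w. ?G n w \<longrightarrow>
        P_stat (p n) n (\<lambda>i. X n i w) \<le> 1 - 4 * ln (real n) + ln (ln (real n))"
      \<comment> \<open>The bound on the maximum starts at \<open>n = 2\<close>, where the first
        pair exists.\<close>
      using eventually_ge_at_top[of 2]
    proof eventually_elim
      case (elim n)
      then show ?case using P_stat_all_obtuse[of "p n" n] dim[of n] by simp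
    qed
    show "filterlim (\<lambda>n. 1 - 4 * ln (real n) + ln (ln (real n))) at_bot sequentially" by real_asymp
  qed (use X in \<open>auto intro!: measurable_P_stat\<close>)
  ultimately show ?thesis by blast
qed

end
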